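(* Suppose that $\varphi$ is in $H^2(\mathbb{T})$. Then the Hankel operator $\mathbf{H}_\varphi$ has minimal norm, that is, $\|\mathbf{H}_\varphi\| = \|\varphi\|_{H^2(\mathbb{T})}$, if and only if $\varphi$ is a constant multiple of an inner function, i.e. $\varphi = C I$ for some complex constant $C$ and some inner function $I$.
   Context: The unit circle $\mathbb{T}$ is equipped with its normalized Haar measure. $H^2(\mathbb{T})$ is the subspace of $L^2(\mathbb{T})$ of functions whose Fourier coefficients are supported on $\mathbb{N}_0=\{0,1,2,\ldots\}$, and $\overline{H^2}(\mathbb{T})$ is the subspace of $L^2(\mathbb{T})$ of complex conjugates of functions in $H^2(\mathbb{T})$. Let $\overline{P}$ be the orthogonal projection from $L^2(\mathbb{T})$ to $\overline{H^2}(\mathbb{T})$. For $\varphi$ in $H^2(\mathbb{T})$ the Hankel operator $\mathbf{H}_\varphi$ from $H^2(\mathbb{T})$ to $\overline{H^2}(\mathbb{T})$ is $\mathbf{H}_\varphi f = \overline{P}(\overline{\varphi} f)$; it is initially defined for (analytic) polynomials $f$, and $\|\mathbf{H}_\varphi\|\in[0,\infty]$ denotes the supremum of $\|\mathbf{H}_\varphi f\|_{L^2}$ over polynomials $f$ with $\|f\|_{H^2}=1$ (the operator extends to a bounded operator on $H^2(\mathbb{T})$ when this is finite). A function $I$ in $H^2(\mathbb{T})$ is called inner if $|I(z)|=1$ for almost every $z$ in $\mathbb{T}$. *)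

theory Defs
  imports "HOL-Probability.Probability" "HOL-Computational_Algebra.Polynomial"
begin

definition circle_measure :: "complex measure" where
  "circle_measure =
     distr (uniform_measure lborel {0..<2 * pi}) (restrict_space borel (sphere 0 1)) cis"

lemma cis_measurable_sphere:
  "cis \<in> measurable (uniform_measure lborel {0..<2 * pi}) (restrict_space borel (sphere 0 1))"
proof (rule measurable_restrict_space2)
  show "cis \<in> space (uniform_measure lborel {0..<2 * pi}) \<rightarrow> sphere 0 1"
    by auto
  have "continuous_on UNIV cis"
    by (intro continuous_intros)
  then show "cis \<in> borel_measurable (uniform_measure lborel {0..<2 * pi})"
    using borel_measurable_continuous_onI by (simp cong: measurable_cong_sets)
qed

lemma prob_space_circle_measure: "prob_space circle_measure"
  unfolding circle_measure_def
  by (intro prob_space.prob_space_distr prob_space_uniform_measure cis_measurable_sphere)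
    (simp_all add: ennreal_eq_0_iff not_le)

lemma space_circle_measure [simp]: "space circle_measure = sphere 0 1"
  by (simp add: circle_measure_def space_restrict_space)

lemma sets_circle_measure [simp, measurable_cong]:
  "sets circle_measure = sets (restrict_space borel (sphere 0 1))"
  by (simp add: circle_measure_def)

(* Elements of L2 are represented by functions, not by classes modulo a.e. equality. *)
definition L2_circle :: "(complex \<Rightarrow> complex) set" where
  "L2_circle = {f \<in> borel_measurable circle_measure.
     integrable circle_measure (\<lambda>z. (cmod (f z))\<^sup>2)}"

definition L2_inner :: "(complex \<Rightarrow> complex) \<Rightarrow> (complex \<Rightarrow> complex) \<Rightarrow> complex" where
  "L2_inner f g = (LINT z|circle_measure. f z * cnj (g z))"

definition L2_norm :: "(complex \<Rightarrow> complex) \<Rightarrow> real" where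
  "L2_norm f = sqrt (LINT z|circle_measure. (cmod (f z))\<^sup>2)"

definition fourier_coeff :: "(complex \<Rightarrow> complex) \<Rightarrow> int \<Rightarrow> complex" where
  "fourier_coeff f n = (LINT z|circle_measure. f z * cnj (z powi n))"

definition H2 :: "(complex \<Rightarrow> complex) set" where
  "H2 = {f \<in> L2_circle. \<forall>n<0. fourier_coeff f n = 0}"

definition H2_conj :: "(complex \<Rightarrow> complex) set" where
  "H2_conj = (\<lambda>f z. cnj (f z)) ` H2"

(* The orthogonal projection of an L2 function onto H2_conj is determined only up to a.e.
   equality; SOME picks a representative. Note that H2_conj contains the constants. *)
definition proj_H2_conj :: "(complex \<Rightarrow> complex) \<Rightarrow> complex \<Rightarrow> complex" where
  "proj_H2_conj f = (SOME g. g \<in> H2_conj \<and>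
     (\<forall>h\<in>H2_conj. L2_inner (\<lambda>z. f z - g z) h = 0))"

definition hankel :: "(complex \<Rightarrow> complex) \<Rightarrow> (complex \<Rightarrow> complex) \<Rightarrow> complex \<Rightarrow> complex" where
  "hankel \<phi> f = proj_H2_conj (\<lambda>z. cnj (\<phi> z) * f z)"

definition hankel_norm :: "(complex \<Rightarrow> complex) \<Rightarrow> ennreal" where
  "hankel_norm \<phi> =
     (SUP p \<in> {p :: complex poly. L2_norm (poly p) = 1}. ennreal (L2_norm (hankel \<phi> (poly p))))"

definition inner_function :: "(complex \<Rightarrow> complex) \<Rightarrow> bool" where
  "inner_function I \<longleftrightarrow> I \<in> H2 \<and> (AE z in circle_measure. cmod (I z) = 1)"

end

theory Submission
  imports Defs
begin

text \<open>
  Since \<open>\<H>\<^sub>\<phi> 1 = cnj \<phi>\<close>, the norm is always at least \<open>\<parallel>\<phi>\<parallel>\<close>. If it is equal to \<open>\<parallel>\<phi>\<parallel>\<close>, pairing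
  \<open>\<H>\<^sub>\<phi> p\<close> with \<open>cnj \<phi>\<close> gives \<open>Re (\<integral> \<bar>\<phi>\<bar>\<^sup>2 p) \<le> \<parallel>\<phi>\<parallel>\<^sup>2\<close> for all polynomials \<open>p\<close> of norm 1. Testing this with
  normalizations of \<open>1 + c z\<^sup>n\<close> for small \<open>c\<close> shows that the nonzero Fourier coefficients of \<open>\<bar>\<phi>\<bar>\<^sup>2\<close>
  vanish, so \<open>\<bar>\<phi>\<bar>\<close> is constant. Conversely, if \<open>\<bar>\<phi>\<bar> = \<bar>C\<bar>\<close>, then \<open>\<H>\<^sub>\<phi>\<close> is a multiplication of norm
  \<open>\<bar>C\<bar>\<close> followed by a contraction.
\<close>

section \<open>Integration on the circle\<close>

interpretation circle: prob_space circle_measure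
  by (rule prob_space_circle_measure)

lemma borel_measurable_circle_continuous:
  assumes "continuous_on (sphere 0 1) f"
  shows "f \<in> borel_measurable circle_measure"
  using borel_measurable_continuous_on_restrict[OF assms]
  by (simp cong: measurable_cong_sets)

lemma borel_measurable_circle:
  assumes "f \<in> borel_measurable borel"
  shows "f \<in> borel_measurable circle_measure"
  using measurable_restrict_space1[OF assms, of "sphere 0 1"]
  by (simp cong: measurable_cong_sets)

text \<open>A continuous factor is bounded on the compact circle. Asking for continuity only on
  \<open>sphere 0 1\<close> admits the powers \<open>z powi n\<close> with negative
  \<open>n\<close>.\<close>

lemma integrable_mult_continuous:
  fixes f u :: "complex \<Rightarrow> complex"
  assumes u: "integrable circle_measure u" and f: "continuous_on (sphere 0 1) f"
  shows "integrable circle_measure (\<lambda>z. f z * u z)"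
proof -
  have "bounded (f ` sphere 0 1)"
    by (intro compact_imp_bounded compact_continuous_image f) simp
  then obtain B where B: "\<And>z. z \<in> sphere 0 1 \<Longrightarrow> cmod (f z) \<le> B"
    by (fastforce simp: bounded_iff)
  show ?thesis
  proof (rule Bochner_Integration.integrable_bound)
    show "integrable circle_measure (\<lambda>z. B * cmod (u z))"
      using u by simp
    show "(\<lambda>z. f z * u z) \<in> borel_measurable circle_measure"
      using u borel_measurable_circle_continuous[OF f] by simp
    show "AE z in circle_measure. cmod (f z * u z) \<le> norm (B * cmod (u z))"
    proof (rule AE_I2)
      fix z assume "z \<in> space circle_measure"
      then have "cmod (f z) \<le> B" using B by simp
      then have "cmod (f z) * cmod (u z) \<le> \<bar>B\<bar> * cmod (u z)"
        by (intro mult_right_mono) auto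
      then show "cmod (f z * u z) \<le> norm (B * cmod (u z))"
        by (simp add: norm_mult abs_mult)
    qed
  qed
qed

lemma integrable_mult_continuous_right:
  fixes f u :: "complex \<Rightarrow> complex"
  assumes "integrable circle_measure u" "continuous_on (sphere 0 1) f"
  shows "integrable circle_measure (\<lambda>z. u z * f z)"
  using integrable_mult_continuous[OF assms] by (simp add: mult.commute)

lemma integrable_circle_continuous:
  fixes f :: "complex \<Rightarrow> complex"
  assumes "continuous_on (sphere 0 1) f"
  shows "integrable circle_measure f"
  using integrable_mult_continuous[of "\<lambda>_. 1" f] assms by simp

lemma continuous_on_powi_circle [continuous_intros]:
  "continuous_on (sphere 0 1) (\<lambda>z::complex. z powi n)"
  by (intro continuous_intros) auto

lemma cnj_eq_inverse_circle: "cmod z = 1 \<Longrightarrow> cnj z = inverse z"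
  by (metis complex_cnj_one complex_cnj_mult complex_cnj_cnj complex_mod_cnj complex_norm_square
      inverse_unique of_real_1 power_one mult.commute)

lemma cnj_powi_circle: "cmod z = 1 \<Longrightarrow> cnj z powi n = z powi (- n)"
  by (simp add: cnj_eq_inverse_circle power_int_inverse power_int_minus)

lemma powi_mult_circle: "cmod z = 1 \<Longrightarrow> z powi m * z powi n = z powi (m + n)"
  by (subst power_int_add) auto

text \<open>Orthogonality of the characters: pulling back along \<open>cis\<close> leaves the
  integral of \<open>cis (n * t)\<close> over one period, and for \<open>n \<noteq> 0\<close> its
  antiderivative \<open>?F\<close> takes equal values at both ends.\<close>

lemma integral_powi_circle: "(LINT z|circle_measure. z powi n) = (if n = 0 then 1 else 0)"
proof (cases "n = 0")
  case True
  then show ?thesis using circle.prob_space by simp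
next
  case False
  let ?F = "\<lambda>t::real. cis (of_int n * t) / (\<i> * of_int n)"
  have um: "uniform_measure lborel {0..<2 * pi} =
      density lborel (\<lambda>t. ennreal (indicator {0..<2 * pi} t / (2 * pi)))"
    unfolding uniform_measure_def
    by (intro density_cong) (auto simp: divide_ennreal[symmetric] ennreal_indicator)
  have "(LINT z|circle_measure. z powi n) = (LINT t|uniform_measure lborel {0..<2 * pi}. cis t powi n)"
    unfolding circle_measure_def
    by (rule integral_distr[OF cis_measurable_sphere])
       (auto intro!: borel_measurable_continuous_on_restrict continuous_intros)
  also have "\<dots> = (LINT t|lborel. (indicator {0..<2 * pi} t / (2 * pi)) *\<^sub>R cis (of_int n * t))"
    unfolding um
    by (subst integral_density) (auto simp: cis_power_int intro!: borel_measurable_continuous_onI continuous_intros)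
  \<comment> \<open>The fundamental theorem of calculus is applied on a closed interval; adding the
    endpoint \<open>2 * pi\<close> changes the integrand on a null set only.\<close>
  also have "\<dots> = (LINT t|lborel. (1 / (2 * pi)) *\<^sub>R (indicator {0..2 * pi} t *\<^sub>R cis (of_int n * t)))"
  proof (rule integral_cong_AE)
    show "AE t in lborel. (indicator {0..<2 * pi} t / (2 * pi)) *\<^sub>R cis (of_int n * t) =
       (1 / (2 * pi)) *\<^sub>R (indicator {0..2 * pi} t *\<^sub>R cis (of_int n * t))"
      using AE_lborel_singleton[of "2 * pi"] by eventually_elim (auto simp: indicator_def)
    have [measurable]: "(\<lambda>t. cis (of_int n * t)) \<in> borel_measurable borel"
      by (intro borel_measurable_continuous_onI continuous_intros)
    show "(\<lambda>t. (indicator {0..<2 * pi} t / (2 * pi)) *\<^sub>R cis (of_int n * t)) \<in> borel_measurable lborel"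
      "(\<lambda>t. (1 / (2 * pi)) *\<^sub>R (indicator {0..2 * pi} t *\<^sub>R cis (of_int n * t))) \<in> borel_measurable lborel"
      by simp_all
  qed
  also have "\<dots> = (1 / (2 * pi)) *\<^sub>R (LINT t|lborel. indicator {0..2 * pi} t *\<^sub>R cis (of_int n * t))"
    by (rule Bochner_Integration.integral_scaleR_right)
  also have "(LINT t|lborel. indicator {0..2 * pi} t *\<^sub>R cis (of_int n * t)) = ?F (2 * pi) - ?F 0"
  proof (rule integral_FTC_Icc)
    show "(?F has_vector_derivative cis (of_int n * t)) (at t within {0..2 * pi})" for t
    proof -
      have "((\<lambda>t. exp (\<i> * of_int n * complex_of_real t) / (\<i> * of_int n))
          has_vector_derivative exp (\<i> * of_int n * complex_of_real t)) (at t within {0..2 * pi})"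
        using False
        by (auto intro!: derivative_eq_intros has_vector_derivative_real_field)
      then show ?thesis by (simp add: cis_conv_exp mult.assoc)
    qed
    show "continuous_on {0..2 * pi} (\<lambda>t. cis (of_int n * t))"
      by (intro continuous_intros)
  qed simp
  also have "cis (of_int n * (2 * pi)) = 1"
    using cis_multiple_2pi[of "of_int n"] by (simp add: mult.commute mult.left_commute)
  finally show ?thesis using False by simp
qed

section \<open>Uniqueness of Fourier coefficients\<close>

text \<open>On the circle \<open>cnj z\<close> is the inverse of \<open>z\<close>, so multiplication
  by a real coordinate function only shifts and combines Fourier coefficients, and vanishing
  coefficients stay zero. Induction on the polynomial spreads this to sums and products.\<close>

lemma fourier_null_mult_real_polynomial:
  fixes g :: "complex \<Rightarrow> real" and u :: "complex \<Rightarrow> complex"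
  assumes "real_polynomial_function g" "integrable circle_measure u" "\<And>n. fourier_coeff u n = 0"
  shows "integrable circle_measure (\<lambda>z. g z * u z) \<and> (\<forall>n. fourier_coeff (\<lambda>z. g z * u z) n = 0)"
  using assms
proof (induction arbitrary: u)
  case (linear f)
  \<comment> \<open>These come from \<open>f z = Re z * f 1 + Im z * f \<i>\<close> on substituting
    \<open>Re z = (z + cnj z) / 2\<close> and
    \<open>Im z = (z - cnj z) / (2 * \<i>)\<close>.\<close>
  define a b where "a = (f 1 - \<i> * f \<i>) / 2" and "b = (f 1 + \<i> * f \<i>) / 2"
  have ab: "complex_of_real (f z) = a * z + b * cnj z" for z
  proof -
    have "f z = f (Re z *\<^sub>R 1 + Im z *\<^sub>R \<i>)"
      by (intro arg_cong[of _ _ f]) (simp add: complex_eq_iff)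
    also have "\<dots> = Re z * f 1 + Im z * f \<i>"
      using linear(1) by (simp add: linear_simps)
    finally show ?thesis
      by (simp add: a_def b_def complex_eq_iff field_simps)
  qed
  have int: "integrable circle_measure (\<lambda>z. z powi n * u z)" for n
    by (intro integrable_mult_continuous linear.prems continuous_intros)
  have zero: "(LINT z|circle_measure. z powi n * u z) = 0" for n
  proof -
    have "(LINT z|circle_measure. z powi n * u z) = fourier_coeff u (- n)"
      unfolding fourier_coeff_def
      by (intro Bochner_Integration.integral_cong) (auto simp: cnj_powi_circle)
    then show ?thesis using linear.prems by simp
  qed
  have cont: "continuous_on (sphere 0 1) f"
    using linear(1) linear_continuous_on by blast
  have "fourier_coeff (\<lambda>z. f z * u z) n = 0" for n
  proof -
    have "fourier_coeff (\<lambda>z. f z * u z) n =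
        (LINT z|circle_measure. a * (z powi (1 - n) * u z) + b * (z powi (- 1 - n) * u z))"
      unfolding fourier_coeff_def
    proof (intro Bochner_Integration.integral_cong refl)
      fix z assume "z \<in> space circle_measure"
      then have z: "cmod z = 1" by simp
      have "z powi (1 - n) = z * z powi (-n)" "z powi (-1 - n) = cnj z * z powi (-n)"
        using z powi_mult_circle[OF z, of 1 "-n"] powi_mult_circle[OF z, of "-1" "-n"]
        by (auto simp: cnj_eq_inverse_circle power_int_minus)
      then show "f z * u z * cnj (z powi n) = a * (z powi (1 - n) * u z) + b * (z powi (- 1 - n) * u z)"
        using z by (simp add: cnj_powi_circle ab algebra_simps)
    qed
    also have "\<dots> = 0" by (simp add: int zero)
    finally show ?thesis .
  qed
  moreover have "integrable circle_measure (\<lambda>z. f z * u z)"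
    by (intro integrable_mult_continuous linear.prems continuous_intros cont)
  ultimately show ?case by blast
next
  case (const c)
  have "fourier_coeff (\<lambda>z. complex_of_real c * u z) n = complex_of_real c * fourier_coeff u n" for n
    unfolding fourier_coeff_def by (simp add: mult.assoc)
  then show ?case using const by simp
next
  case (add f g)
  have *: "integrable circle_measure (\<lambda>z. f z * u z)" "integrable circle_measure (\<lambda>z. g z * u z)"
    "\<And>n. fourier_coeff (\<lambda>z. f z * u z) n = 0" "\<And>n. fourier_coeff (\<lambda>z. g z * u z) n = 0"
    using add by blast+
  have int: "integrable circle_measure (\<lambda>z. v z * cnj (z powi n))"
    if "integrable circle_measure v" for v n
    by (intro integrable_mult_continuous_right that continuous_on_cnj continuous_on_powi_circle)
  have "fourier_coeff (\<lambda>z. f z * u z + g z * u z) n = 0" for n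
    using *(3,4)[of n] int[OF *(1)] int[OF *(2)]
    unfolding fourier_coeff_def by (simp add: distrib_right)
  then show ?case using *(1,2) by (simp add: distrib_right)
next
  \<comment> \<open>The hypothesis for \<open>f\<close> is used with \<open>g * u\<close> in place
    of \<open>u\<close>, which is why the induction generalizes over \<open>u\<close>.\<close>
  case (mult f g)
  have "integrable circle_measure (\<lambda>z. f z * (g z * u z)) \<and>
    (\<forall>n. fourier_coeff (\<lambda>z. f z * (g z * u z)) n = 0)"
    using mult by blast
  then show ?case by (simp add: mult.assoc)
qed

text \<open>By Stone-Weierstrass \<open>f\<close> is uniformly within \<open>e\<close> of a real
  polynomial \<open>g\<close>. The integral of \<open>g * u\<close> is a zeroth Fourier coefficient,
  hence 0, and the error is at most \<open>e\<close> times the \<open>L1\<close> norm of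
  \<open>u\<close>.\<close>

lemma fourier_null_integral_continuous:
  fixes f :: "complex \<Rightarrow> real" and u :: "complex \<Rightarrow> complex"
  assumes u: "integrable circle_measure u" and "\<And>n. fourier_coeff u n = 0"
    and f: "continuous_on (sphere 0 1) f"
  shows "(LINT z|circle_measure. f z * u z) = 0"
proof -
  let ?K = "LINT z|circle_measure. cmod (u z)"
  have fu: "integrable circle_measure (\<lambda>z. f z * u z)"
    by (intro integrable_mult_continuous u continuous_on_of_real f)
  have "cmod (LINT z|circle_measure. f z * u z) \<le> e * ?K" if "e > 0" for e
  proof -
    obtain g where g: "real_polynomial_function g" "\<And>z. z \<in> sphere 0 1 \<Longrightarrow> \<bar>f z - g z\<bar> < e"
      using Stone_Weierstrass_real_polynomial_function[OF compact_sphere f \<open>e > 0\<close>] by blast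
    have gu: "integrable circle_measure (\<lambda>z. g z * u z)" "fourier_coeff (\<lambda>z. g z * u z) 0 = 0"
      using fourier_null_mult_real_polynomial[OF g(1) assms(1,2)] by auto
    have "(LINT z|circle_measure. f z * u z) = (LINT z|circle_measure. f z * u z - g z * u z)"
      using gu fu by (simp add: fourier_coeff_def)
    also have "cmod \<dots> \<le> (LINT z|circle_measure. cmod (f z * u z - g z * u z))"
      by (rule integral_norm_bound)
    also have "\<dots> \<le> (LINT z|circle_measure. e * cmod (u z))"
    proof (rule integral_mono)
      show "integrable circle_measure (\<lambda>z. cmod (f z * u z - g z * u z))"
        using fu gu by simp
      show "integrable circle_measure (\<lambda>z. e * cmod (u z))" using u by simp
      fix z assume "z \<in> space circle_measure"
      then have "\<bar>f z - g z\<bar> \<le> e" using g(2)[of z] by simp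
      moreover have "cmod (f z * u z - g z * u z) = \<bar>f z - g z\<bar> * cmod (u z)"
        by (metis left_diff_distrib norm_mult norm_of_real of_real_diff)
      ultimately show "cmod (f z * u z - g z * u z) \<le> e * cmod (u z)"
        by (simp add: mult_right_mono)
    qed
    finally show ?thesis by simp
  qed
  note bound = this
  have K: "?K \<ge> 0" by simp
  have "cmod (LINT z|circle_measure. f z * u z) \<le> 0 + e" if "e > 0" for e
  proof -
    \<comment> \<open>Dividing by \<open>?K + 1\<close> rather than \<open>?K\<close> covers the
      case \<open>?K = 0\<close>.\<close>
    have "cmod (LINT z|circle_measure. f z * u z) \<le> e / (?K + 1) * ?K"
      using that K by (intro bound divide_pos_pos) linarith+
    also have "\<dots> \<le> e" using that K by (simp add: pos_divide_le_eq add_nonneg_pos)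
    finally show ?thesis by simp
  qed
  then have "cmod (LINT z|circle_measure. f z * u z) \<le> 0"
    by (rule field_le_epsilon)
  then show ?thesis by simp
qed

text \<open>The indicator of a closed set is the pointwise limit of powers of a continuous function,
  so dominated convergence carries the continuous case over.\<close>

lemma fourier_null_integral_closed:
  fixes u :: "complex \<Rightarrow> complex"
  assumes u: "integrable circle_measure u" and "\<And>n. fourier_coeff u n = 0" and C: "closed C"
  shows "(LINT z|circle_measure. indicator C z *\<^sub>R u z) = 0"
proof (cases "C = {}")
  case False
  \<comment> \<open>\<open>h\<close> equals 1 on \<open>C\<close> and lies in \<open>[0, 1)\<close>
    off \<open>C\<close>, so \<open>h z ^ k\<close> tends to the indicator. The empty set is treated
    apart because \<open>infdist z {} = 0\<close> would make \<open>h\<close> constantly 1.\<close>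
  define h where "h z = max 0 (1 - infdist z C)" for z
  have h: "0 \<le> h z" "h z \<le> 1" for z by (auto simp: h_def infdist_nonneg)
  have conth: "continuous_on A h" for A
    unfolding h_def by (intro continuous_intros)
  have "(\<lambda>k. LINT z|circle_measure. h z ^ k *\<^sub>R u z) \<longlonglongrightarrow> (LINT z|circle_measure. indicator C z *\<^sub>R u z)"
  proof (rule integral_dominated_convergence)
    show "integrable circle_measure (\<lambda>z. cmod (u z))" using u by simp
    show "(\<lambda>z. indicator C z *\<^sub>R u z) \<in> borel_measurable circle_measure"
      using C by (intro borel_measurable_scaleR[OF borel_measurable_circle borel_measurable_integrable[OF u]]) simp
    show "(\<lambda>z. h z ^ k *\<^sub>R u z) \<in> borel_measurable circle_measure" for k
      using u borel_measurable_circle_continuous[OF conth] by simp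
    show "AE z in circle_measure. (\<lambda>k. h z ^ k *\<^sub>R u z) \<longlonglongrightarrow> indicator C z *\<^sub>R u z"
    proof (intro AE_I2 tendsto_scaleR tendsto_const)
      fix z
      show "(\<lambda>k. h z ^ k) \<longlonglongrightarrow> indicator C z"
      proof (cases "z \<in> C")
        case True
        then show ?thesis by (simp add: h_def)
      next
        case zC: False
        then have "infdist z C > 0"
          using C False by (simp add: infdist_pos_not_in_closed)
        then have "h z < 1" by (simp add: h_def)
        then show ?thesis using zC h(1)[of z] by (simp add: LIMSEQ_power_zero)
      qed
    qed
    show "AE z in circle_measure. cmod (h z ^ k *\<^sub>R u z) \<le> cmod (u z)" for k
      using h by (auto intro!: mult_left_le_one_le power_le_one)
  qed
  moreover have "(LINT z|circle_measure. h z ^ k *\<^sub>R u z) = 0" for k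
    using fourier_null_integral_continuous[OF assms(1,2), of "\<lambda>z. h z ^ k"] conth
    by (simp add: scaleR_conv_of_real continuous_on_power)
  ultimately show ?thesis by (simp add: LIMSEQ_const_iff)
qed simp

text \<open>The closed sets form an intersection-stable generator of the Borel sets, so a
  Dynkin-system induction extends the vanishing of the integral of \<open>u\<close> from closed sets
  to all Borel sets. A function whose integral over every measurable set is 0 vanishes almost
  everywhere.\<close>

lemma fourier_coeff_unique_zero:
  assumes u: "integrable circle_measure u" and zero: "\<And>n. fourier_coeff u n = 0"
  shows "AE z in circle_measure. u z = 0"
proof (rule circle.density_zero[OF u])
  have int: "integrable circle_measure (\<lambda>z. indicator A z *\<^sub>R u z)" if "A \<in> sets borel" for A
  proof (rule Bochner_Integration.integrable_bound[OF u])
    show "(\<lambda>z. indicator A z *\<^sub>R u z) \<in> borel_measurable circle_measure"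
      using that by (intro borel_measurable_scaleR[OF borel_measurable_circle borel_measurable_integrable[OF u]]) simp
  qed (simp add: indicator_def)
  have borel: "(LINT z|circle_measure. indicator A z *\<^sub>R u z) = 0" if "A \<in> sets borel" for A
  proof -
    have borel_eq: "sets borel = sigma_sets UNIV (Collect closed :: complex set set)"
      by (simp add: borel_eq_closed)
    have "Int_stable (Collect closed :: complex set set)" "Collect closed \<subseteq> Pow (UNIV :: complex set)"
      by (auto simp: Int_stable_def)
    moreover have "A \<in> sigma_sets UNIV (Collect closed)" using that borel_eq by simp
    ultimately show ?thesis
    proof (induction rule: sigma_sets_induct_disjoint)
      case (basic A)
      then show ?case using fourier_null_integral_closed[OF u zero] by simp
    next
      case empty
      show ?case by simp
    next
      case (compl A)
      then have A: "A \<in> sets borel" using borel_eq by simp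
      have "(LINT z|circle_measure. indicator (UNIV - A) z *\<^sub>R u z) =
          (LINT z|circle_measure. u z - indicator A z *\<^sub>R u z)"
        by (intro Bochner_Integration.integral_cong) (auto simp: indicator_def)
      also have "\<dots> = (LINT z|circle_measure. u z)"
        using int[OF A] u compl by simp
      \<comment> \<open>The total integral of \<open>u\<close> is its zeroth Fourier
        coefficient.\<close>
      also have "\<dots> = 0" using zero[of 0] by (simp add: fourier_coeff_def)
      finally show ?case .
    next
      case (union A)
      then have A: "A i \<in> sets borel" for i using borel_eq by auto
      \<comment> \<open>Countable additivity: the finite partial unions converge to the full union,
        with \<open>cmod (u z)\<close> as dominating function.\<close>
      have "(\<lambda>n. LINT z|circle_measure. indicator (\<Union>i<n. A i) z *\<^sub>R u z)
          \<longlonglongrightarrow> (LINT z|circle_measure. indicator (\<Union>i. A i) z *\<^sub>R u z)"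
      proof (rule integral_dominated_convergence)
        show "integrable circle_measure (\<lambda>z. cmod (u z))" using u by simp
        show "(\<lambda>z. indicator (\<Union>i. A i) z *\<^sub>R u z) \<in> borel_measurable circle_measure"
          "(\<lambda>z. indicator (\<Union>i<n. A i) z *\<^sub>R u z) \<in> borel_measurable circle_measure" for n
          using A by (auto intro!: borel_measurable_integrable[OF int])
        show "AE z in circle_measure. (\<lambda>n. indicator (\<Union>i<n. A i) z *\<^sub>R u z)
            \<longlonglongrightarrow> indicator (\<Union>i. A i) z *\<^sub>R u z"
          by (intro AE_I2 tendsto_scaleR tendsto_const LIMSEQ_indicator_UN)
        show "AE z in circle_measure. cmod (indicator (\<Union>i<n. A i) z *\<^sub>R u z) \<le> cmod (u z)" for n
          by (auto simp: indicator_def)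
      qed
      moreover have "(LINT z|circle_measure. indicator (\<Union>i<n. A i) z *\<^sub>R u z) = 0" for n
      proof -
        have "indicator (\<Union>i<n. A i) z *\<^sub>R u z = (\<Sum>i<n. indicator (A i) z *\<^sub>R u z)" for z
        proof -
          have "indicat_real (\<Union>i<n. A i) z = (\<Sum>i<n. indicator (A i) z)"
            using union(1) by (intro indicator_UN_disjoint) (auto simp: disjoint_family_on_def)
          then show ?thesis by (simp only: scaleR_sum_left)
        qed
        then have "(LINT z|circle_measure. indicator (\<Union>i<n. A i) z *\<^sub>R u z) =
            (LINT z|circle_measure. (\<Sum>i<n. indicator (A i) z *\<^sub>R u z))"
          by (simp only:)
        also have "\<dots> = (\<Sum>i<n. LINT z|circle_measure. indicator (A i) z *\<^sub>R u z)"
          by (rule Bochner_Integration.integral_sum) (rule int[OF A])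
        finally show ?thesis using union(3) by simp
      qed
      ultimately show ?case by (simp add: LIMSEQ_const_iff)
    qed
  qed
  fix A assume "A \<in> sets circle_measure"
  then obtain B where B: "B \<in> sets borel" "A = sphere 0 1 \<inter> B"
    by (auto simp: sets_restrict_space)
  then have "A \<in> sets borel" by auto
  then show "set_lebesgue_integral circle_measure A u = 0"
    using borel by (simp add: set_lebesgue_integral_def)
qed


section \<open>The spaces and the projection\<close>

lemma L2_circle_norm_integrable:
  "f \<in> L2_circle \<Longrightarrow> integrable circle_measure (\<lambda>z. (cmod (f z))\<^sup>2)"
  by (simp add: L2_circle_def)

lemma L2_circle_measurable: "f \<in> L2_circle \<Longrightarrow> f \<in> borel_measurable circle_measure"
  by (simp add: L2_circle_def)

lemma L2_circle_mult_integrable: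
  assumes f: "f \<in> L2_circle" and g: "g \<in> L2_circle"
  shows "integrable circle_measure (\<lambda>z. f z * g z)"
proof (rule Bochner_Integration.integrable_bound)
  show "integrable circle_measure (\<lambda>z. (cmod (f z))\<^sup>2 + (cmod (g z))\<^sup>2)"
    using f g by (simp add: L2_circle_norm_integrable)
  show "(\<lambda>z. f z * g z) \<in> borel_measurable circle_measure"
    by (intro borel_measurable_times L2_circle_measurable f g)
  have "cmod (f z * g z) \<le> norm ((cmod (f z))\<^sup>2 + (cmod (g z))\<^sup>2)" for z
    using sum_squares_bound[of "cmod (f z)" "cmod (g z)"] mult_nonneg_nonneg[of "cmod (f z)" "cmod (g z)"]
    unfolding norm_mult real_norm_def by (simp del: mult_nonneg_nonneg zero_le_mult_iff)
  then show "AE z in circle_measure. cmod (f z * g z) \<le> norm ((cmod (f z))\<^sup>2 + (cmod (g z))\<^sup>2)"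
    by simp
qed

lemma L2_circle_cnj: "f \<in> L2_circle \<Longrightarrow> (\<lambda>z. cnj (f z)) \<in> L2_circle"
  using borel_measurable_continuous_on[OF continuous_on_cnj[OF continuous_on_id]]
  by (auto simp: L2_circle_def)

lemma L2_circle_inner_integrable:
  "f \<in> L2_circle \<Longrightarrow> g \<in> L2_circle \<Longrightarrow> integrable circle_measure (\<lambda>z. f z * cnj (g z))"
  by (intro L2_circle_mult_integrable L2_circle_cnj)

lemma L2_circle_diff:
  assumes f: "f \<in> L2_circle" and g: "g \<in> L2_circle"
  shows "(\<lambda>z. f z - g z) \<in> L2_circle"
proof -
  have [measurable]: "f \<in> borel_measurable circle_measure" "g \<in> borel_measurable circle_measure"
    using f g by (auto simp: L2_circle_measurable)
  have "integrable circle_measure (\<lambda>z. (cmod (f z - g z))\<^sup>2)"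
  proof (rule Bochner_Integration.integrable_bound)
    show "integrable circle_measure (\<lambda>z. 2 * (cmod (f z))\<^sup>2 + 2 * (cmod (g z))\<^sup>2)"
      using f g by (simp add: L2_circle_norm_integrable)
    have "(cmod (f z - g z))\<^sup>2 \<le> 2 * (cmod (f z))\<^sup>2 + 2 * (cmod (g z))\<^sup>2" for z
    proof -
      have "(cmod (f z - g z))\<^sup>2 \<le> (cmod (f z) + cmod (g z))\<^sup>2"
        by (intro power_mono norm_triangle_ineq4) simp
      then show ?thesis
        using sum_squares_bound[of "cmod (f z)" "cmod (g z)"] by (simp add: power2_sum)
    qed
    then show "AE z in circle_measure. norm ((cmod (f z - g z))\<^sup>2) \<le>
        norm (2 * (cmod (f z))\<^sup>2 + 2 * (cmod (g z))\<^sup>2)"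
      by simp
  qed simp
  then show ?thesis by (simp add: L2_circle_def)
qed

lemma L2_circle_mult_continuous:
  assumes f: "f \<in> L2_circle" and c: "continuous_on (sphere 0 1) c"
  shows "(\<lambda>z. f z * c z) \<in> L2_circle"
proof -
  have [measurable]: "f \<in> borel_measurable circle_measure" "c \<in> borel_measurable circle_measure"
    using f c by (auto simp: L2_circle_measurable borel_measurable_circle_continuous)
  have "integrable circle_measure (\<lambda>z. complex_of_real ((cmod (c z))\<^sup>2) * complex_of_real ((cmod (f z))\<^sup>2))"
    using f by (intro integrable_mult_continuous continuous_intros c integrable_of_real
        L2_circle_norm_integrable)
  then have "integrable circle_measure (\<lambda>z. complex_of_real ((cmod (f z * c z))\<^sup>2))"
    by (simp add: norm_mult power_mult_distrib mult.commute)
  then have "integrable circle_measure (\<lambda>z. (cmod (f z * c z))\<^sup>2)"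
    using complex_of_real_integrable_eq by blast
  then show ?thesis by (simp add: L2_circle_def)
qed

lemma L2_circle_continuous: "continuous_on (sphere 0 1) c \<Longrightarrow> c \<in> L2_circle"
  using L2_circle_mult_continuous[of "\<lambda>_. 1" c] by (simp add: L2_circle_def)

lemma L2_norm_power2: "(L2_norm f)\<^sup>2 = (LINT z|circle_measure. (cmod (f z))\<^sup>2)"
  by (simp add: L2_norm_def)

lemma L2_norm_nonneg: "L2_norm f \<ge> 0"
  by (simp add: L2_norm_def)

lemma L2_inner_self: "L2_inner f f = (L2_norm f)\<^sup>2"
  by (simp add: L2_inner_def L2_norm_power2 flip: complex_norm_square of_real_power)

text \<open>Serves twice: as Pythagoras for the projection, and, since the left side is nonnegative,
  as the bound \<open>2 * Re (L2_inner f g) \<le> (L2_norm f)\<^sup>2 + (L2_norm g)\<^sup>2\<close>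
  in place of Cauchy-Schwarz.\<close>

lemma L2_norm_diff_power2:
  assumes f: "f \<in> L2_circle" and g: "g \<in> L2_circle"
  shows "(L2_norm (\<lambda>z. f z - g z))\<^sup>2 = (L2_norm f)\<^sup>2 + (L2_norm g)\<^sup>2 - 2 * Re (L2_inner f g)"
proof -
  have fg: "integrable circle_measure (\<lambda>z. f z * cnj (g z))"
    using f g by (rule L2_circle_inner_integrable)
  have "(cmod (f z - g z))\<^sup>2 = (cmod (f z))\<^sup>2 + (cmod (g z))\<^sup>2 - 2 * Re (f z * cnj (g z))" for z
    unfolding cmod_power2 by (simp add: power2_eq_square algebra_simps)
  then show ?thesis
    using f g fg
    by (simp add: L2_norm_power2 L2_inner_def L2_circle_norm_integrable del: times_complex.sel)
qed

lemma fourier_coeff_cnj: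
  "fourier_coeff (\<lambda>z. cnj (f z)) n = cnj (fourier_coeff f (- n))"
proof -
  have "fourier_coeff (\<lambda>z. cnj (f z)) n = (LINT z|circle_measure. cnj (f z * cnj (z powi (- n))))"
    unfolding fourier_coeff_def
    by (intro Bochner_Integration.integral_cong) (auto simp: cnj_powi_circle)
  also have "\<dots> = cnj (fourier_coeff f (- n))"
    unfolding fourier_coeff_def by (rule Bochner_Integration.integral_cnj)
  finally show ?thesis .
qed

lemma H2_L2: "f \<in> H2 \<Longrightarrow> f \<in> L2_circle"
  by (simp add: H2_def)

lemma H2_conj_L2: "f \<in> H2_conj \<Longrightarrow> f \<in> L2_circle"
  by (auto simp: H2_conj_def H2_L2 L2_circle_cnj)

text \<open>Conjugation reflects Fourier coefficients through index 0, which turns membership in an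
  image into a condition on the coefficients alone.\<close>

lemma H2_conj_iff: "f \<in> H2_conj \<longleftrightarrow> f \<in> L2_circle \<and> (\<forall>n>0. fourier_coeff f n = 0)"
proof
  assume "f \<in> H2_conj"
  then show "f \<in> L2_circle \<and> (\<forall>n>0. fourier_coeff f n = 0)"
    by (auto simp: H2_conj_def H2_def L2_circle_cnj fourier_coeff_cnj)
next
  assume "f \<in> L2_circle \<and> (\<forall>n>0. fourier_coeff f n = 0)"
  then have "(\<lambda>z. cnj (f z)) \<in> H2"
    by (auto simp: H2_def L2_circle_cnj fourier_coeff_cnj)
  then show "f \<in> H2_conj"
    unfolding H2_conj_def by (rule rev_image_eqI) simp
qed

lemma fourier_coeff_powi: "fourier_coeff (\<lambda>z. z powi m) n = (if m = n then 1 else 0)"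
proof -
  have "fourier_coeff (\<lambda>z. z powi m) n = (LINT z|circle_measure. z powi (m - n))"
    unfolding fourier_coeff_def
    by (intro Bochner_Integration.integral_cong) (auto simp: cnj_powi_circle powi_mult_circle)
  then show ?thesis by (simp add: integral_powi_circle)
qed

text \<open>Only finitely many Fourier coefficients have to be removed here, so completeness of
  \<open>L\<^sup>2\<close> is not needed for the existence of the projection.\<close>

lemma projection_exists:
  assumes f: "f \<in> L2_circle" and N: "\<And>n. n > N \<Longrightarrow> fourier_coeff f n = 0"
  shows "\<exists>g. g \<in> H2_conj \<and> (\<forall>h\<in>H2_conj. L2_inner (\<lambda>z. f z - g z) h = 0)"
proof -
  \<comment> \<open>\<open>t\<close> is the part of \<open>f\<close> with positive frequencies, a
    finite sum because of the bound \<open>N\<close>; the projection is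
    \<open>f - t\<close>.\<close>
  define t where "t z = (\<Sum>k\<in>{1..N}. fourier_coeff f k * z powi k)" for z
  have t: "continuous_on (sphere 0 1) t"
    unfolding t_def by (intro continuous_intros) auto
  have int: "integrable circle_measure (\<lambda>z. h z * cnj (z powi n))" if "h \<in> L2_circle" for h n
    using that by (intro L2_circle_inner_integrable L2_circle_continuous[OF continuous_on_powi_circle])
  have int': "integrable circle_measure (\<lambda>z. z powi m * cnj (h z))" if "h \<in> L2_circle" for h m
    using that by (intro L2_circle_inner_integrable L2_circle_continuous[OF continuous_on_powi_circle])
  have "fourier_coeff (\<lambda>z. f z - t z) n = 0" if "n > 0" for n
  proof -
    have "fourier_coeff t n = (\<Sum>k\<in>{1..N}. fourier_coeff f k * fourier_coeff (\<lambda>z. z powi k) n)"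
      using int[OF L2_circle_continuous[OF continuous_on_powi_circle]]
      by (simp add: fourier_coeff_def t_def sum_distrib_right mult.assoc)
    also have "\<dots> = (\<Sum>k\<in>{1..N}. if k = n then fourier_coeff f k else 0)"
      by (intro sum.cong) (auto simp: fourier_coeff_powi)
    also have "\<dots> = fourier_coeff f n"
      using that N[of n] by (simp add: not_le)
    finally show ?thesis
      using int[OF f] int[OF L2_circle_continuous[OF t]]
      by (simp add: fourier_coeff_def left_diff_distrib)
  qed
  then have "(\<lambda>z. f z - t z) \<in> H2_conj"
    using f t by (simp add: H2_conj_iff L2_circle_diff L2_circle_continuous)
  \<comment> \<open>What was removed is \<open>t\<close>, a combination of positive powers, and
    \<open>h\<close> has no coefficients at positive indices.\<close>
  moreover have "L2_inner (\<lambda>z. f z - (f z - t z)) h = 0" if "h \<in> H2_conj" for h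
  proof -
    have h: "h \<in> L2_circle" using that by (rule H2_conj_L2)
    have "(LINT z|circle_measure. z powi k * cnj (h z)) = 0" if "k \<in> {1..N}" for k
    proof -
      have "(LINT z|circle_measure. z powi k * cnj (h z)) = (LINT z|circle_measure. cnj (h z * cnj (z powi k)))"
        by (simp add: mult.commute)
      also have "\<dots> = cnj (fourier_coeff h k)"
        unfolding fourier_coeff_def by (rule Bochner_Integration.integral_cnj)
      finally show ?thesis using \<open>h \<in> H2_conj\<close> that by (simp add: H2_conj_iff)
    qed
    then show ?thesis
      using int'[OF h] by (simp add: L2_inner_def t_def sum_distrib_right mult.assoc)
  qed
  ultimately show ?thesis by blast
qed

section \<open>Hankel operators on polynomials\<close>

lemma continuous_on_poly_circle: "continuous_on (sphere 0 1) (poly p)" for p :: "complex poly"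
  by (intro continuous_intros)

text \<open>The frequencies of \<open>cnj \<phi>\<close> are at most 0, and the factor
  \<open>z ^ i\<close> raises them by \<open>i \<le> degree p\<close>. This supplies the frequency
  bound for \<open>projection_exists\<close>.\<close>

lemma fourier_coeff_symbol_poly:
  assumes phi: "\<phi> \<in> H2" and n: "n > int (degree p)"
  shows "fourier_coeff (\<lambda>z. cnj (\<phi> z) * poly p z) n = 0"
proof -
  have int: "integrable circle_measure (\<lambda>z. cnj (\<phi> z) * cnj (z powi m))" for m
    using phi by (intro L2_circle_inner_integrable L2_circle_cnj L2_circle_continuous
        continuous_intros H2_L2) auto
  have "fourier_coeff (\<lambda>z. cnj (\<phi> z) * poly p z) n =
     (LINT z|circle_measure. (\<Sum>i\<le>degree p. coeff p i * (cnj (\<phi> z) * cnj (z powi (n - int i)))))"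
    unfolding fourier_coeff_def
  proof (intro Bochner_Integration.integral_cong refl)
    fix z assume "z \<in> space circle_measure"
    then have z: "cmod z = 1" by simp
    have "z ^ i * z powi (- n) = z powi (- (n - int i))" for i
      using powi_mult_circle[OF z, of "int i" "- n"] by simp
    then show "cnj (\<phi> z) * poly p z * cnj (z powi n) =
        (\<Sum>i\<le>degree p. coeff p i * (cnj (\<phi> z) * cnj (z powi (n - int i))))"
      unfolding complex_cnj_power_int cnj_powi_circle[OF z] poly_altdef sum_distrib_left sum_distrib_right
      by (intro sum.cong) (simp_all add: ac_simps)
  qed
  also have "\<dots> = (\<Sum>i\<le>degree p. coeff p i * fourier_coeff (\<lambda>z. cnj (\<phi> z)) (n - int i))"
    using int by (simp add: fourier_coeff_def)
  also have "\<dots> = 0"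
    using phi n by (intro sum.neutral) (auto simp: fourier_coeff_cnj H2_def)
  finally show ?thesis .
qed

text \<open>As a projection exists for these functions, the \<open>SOME\<close> in
  \<open>proj_H2_conj\<close> really picks one. Everything later uses only these two properties of
  the chosen representative.\<close>

lemma hankel_projection:
  assumes "\<phi> \<in> H2"
  shows "hankel \<phi> (poly p) \<in> H2_conj"
    and "h \<in> H2_conj \<Longrightarrow> L2_inner (\<lambda>z. cnj (\<phi> z) * poly p z - hankel \<phi> (poly p) z) h = 0"
proof -
  have "(\<lambda>z. cnj (\<phi> z) * poly p z) \<in> L2_circle"
    using assms by (intro L2_circle_mult_continuous L2_circle_cnj H2_L2 continuous_on_poly_circle)
  from projection_exists[OF this fourier_coeff_symbol_poly[OF assms]]
  have "hankel \<phi> (poly p) \<in> H2_conj \<and>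
    (\<forall>h\<in>H2_conj. L2_inner (\<lambda>z. cnj (\<phi> z) * poly p z - hankel \<phi> (poly p) z) h = 0)"
    unfolding hankel_def proj_H2_conj_def by (rule someI_ex)
  then show "hankel \<phi> (poly p) \<in> H2_conj"
    and "h \<in> H2_conj \<Longrightarrow> L2_inner (\<lambda>z. cnj (\<phi> z) * poly p z - hankel \<phi> (poly p) z) h = 0"
    by auto
qed

text \<open>The projection error is orthogonal to \<open>h\<close>, so pairings with
  \<open>H2_conj\<close> can be computed without knowing the representative.\<close>

lemma hankel_inner:
  assumes phi: "\<phi> \<in> H2" and h: "h \<in> H2_conj"
  shows "L2_inner (hankel \<phi> (poly p)) h = L2_inner (\<lambda>z. cnj (\<phi> z) * poly p z) h"
proof -
  have "integrable circle_measure (\<lambda>z. hankel \<phi> (poly p) z * cnj (h z))"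
    using hankel_projection(1)[OF phi] h by (intro L2_circle_inner_integrable H2_conj_L2)
  moreover have "integrable circle_measure (\<lambda>z. (cnj (\<phi> z) * poly p z) * cnj (h z))"
    using phi h by (intro L2_circle_inner_integrable H2_conj_L2 H2_L2 L2_circle_mult_continuous
        L2_circle_cnj continuous_on_poly_circle)
  ultimately show ?thesis
    using hankel_projection(2)[OF phi h, of p] by (simp add: L2_inner_def left_diff_distrib)
qed

text \<open>Pythagoras: the squared norm of the projection error is the difference of the two
  squared norms, hence that difference is nonnegative.\<close>

lemma hankel_contraction:
  assumes phi: "\<phi> \<in> H2"
  shows "L2_norm (hankel \<phi> (poly p)) \<le> L2_norm (\<lambda>z. cnj (\<phi> z) * poly p z)"
proof -
  let ?f = "\<lambda>z. cnj (\<phi> z) * poly p z" and ?g = "hankel \<phi> (poly p)"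
  have f: "?f \<in> L2_circle"
    using phi by (intro L2_circle_mult_continuous L2_circle_cnj H2_L2 continuous_on_poly_circle)
  have g: "?g \<in> H2_conj" using hankel_projection(1)[OF phi] .
  have "L2_inner ?f ?g = (L2_norm ?g)\<^sup>2"
    using hankel_inner[OF phi g, of p] by (simp add: L2_inner_self)
  then have "(L2_norm (\<lambda>z. ?f z - ?g z))\<^sup>2 = (L2_norm ?f)\<^sup>2 - (L2_norm ?g)\<^sup>2"
    using L2_norm_diff_power2[OF f H2_conj_L2[OF g]] by simp
  then have "(L2_norm ?g)\<^sup>2 \<le> (L2_norm ?f)\<^sup>2"
    using zero_le_power2[of "L2_norm (\<lambda>z. ?f z - ?g z)"] by linarith
  then show ?thesis by (rule power2_le_imp_le) (rule L2_norm_nonneg)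
qed

lemma cnj_H2_in_H2_conj: "\<phi> \<in> H2 \<Longrightarrow> (\<lambda>z. cnj (\<phi> z)) \<in> H2_conj"
  by (auto simp: H2_conj_def)

lemma L2_norm_cnj: "L2_norm (\<lambda>z. cnj (f z)) = L2_norm f"
  by (simp add: L2_norm_def)

text \<open>\<open>cnj \<phi>\<close> already lies in \<open>H2_conj\<close>, but the chosen
  representative need not be that very function. The norms are compared instead through the pairing
  of the two functions, which equals either squared norm according to the order of its
  arguments.\<close>

lemma L2_norm_hankel_one:
  assumes phi: "\<phi> \<in> H2"
  shows "L2_norm (hankel \<phi> (poly 1)) = L2_norm \<phi>"
proof -
  let ?f = "\<lambda>z. cnj (\<phi> z)" and ?g = "hankel \<phi> (poly 1)"
  have f: "?f \<in> H2_conj" using phi by (rule cnj_H2_in_H2_conj)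
  have g: "?g \<in> H2_conj" using hankel_projection(1)[OF phi] .
  have "L2_inner ?g ?f = (L2_norm ?f)\<^sup>2" "L2_inner ?f ?g = (L2_norm ?g)\<^sup>2"
    using hankel_inner[OF phi f, of 1] hankel_inner[OF phi g, of 1] by (simp_all add: L2_inner_self)
  moreover have "Re (L2_inner ?f ?g) = Re (L2_inner ?g ?f)"
  proof -
    have "L2_inner ?f ?g = (LINT z|circle_measure. cnj (?g z * cnj (?f z)))"
      by (simp add: L2_inner_def mult.commute)
    also have "\<dots> = cnj (L2_inner ?g ?f)"
      unfolding L2_inner_def by (rule Bochner_Integration.integral_cnj)
    finally show ?thesis by simp
  qed
  ultimately have "(L2_norm ?g)\<^sup>2 = (L2_norm \<phi>)\<^sup>2"
    by (simp add: L2_norm_cnj flip: of_real_power)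
  then show ?thesis using L2_norm_nonneg by (simp add: power2_eq_iff_nonneg)
qed

lemma L2_norm_one: "L2_norm (poly 1) = 1"
  using circle.prob_space by (simp add: L2_norm_def)

lemma hankel_norm_ge: "\<phi> \<in> H2 \<Longrightarrow> hankel_norm \<phi> \<ge> ennreal (L2_norm \<phi>)"
  unfolding hankel_norm_def
  by (rule SUP_upper2[of 1]) (simp_all add: L2_norm_one L2_norm_hankel_one)

section \<open>Symbols of minimal norm have constant modulus\<close>

lemma hankel_le_of_norm_eq:
  assumes "hankel_norm \<phi> = ennreal (L2_norm \<phi>)" "L2_norm (poly p) = 1"
  shows "L2_norm (hankel \<phi> (poly p)) \<le> L2_norm \<phi>"
proof -
  have "ennreal (L2_norm (hankel \<phi> (poly p))) \<le> hankel_norm \<phi>"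
    unfolding hankel_norm_def using assms(2) by (intro SUP_upper) simp
  then show ?thesis using assms(1) L2_norm_nonneg by (simp add: ennreal_le_iff)
qed

text \<open>The integral is the pairing of \<open>hankel \<phi> (poly p)\<close> with
  \<open>cnj \<phi>\<close>. Both functions have norm at most \<open>L2_norm \<phi>\<close>, so the
  arithmetic-geometric bound on the pairing is enough.\<close>

lemma Re_integral_symbol_poly_le:
  assumes phi: "\<phi> \<in> H2" and eq: "hankel_norm \<phi> = ennreal (L2_norm \<phi>)" and p: "L2_norm (poly p) = 1"
  shows "Re (LINT z|circle_measure. (cmod (\<phi> z))\<^sup>2 * poly p z) \<le> (L2_norm \<phi>)\<^sup>2"
proof -
  let ?f = "\<lambda>z. cnj (\<phi> z)" and ?g = "hankel \<phi> (poly p)"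
  have f: "?f \<in> H2_conj" using phi by (rule cnj_H2_in_H2_conj)
  have g: "?g \<in> H2_conj" using hankel_projection(1)[OF phi] .
  have "L2_inner ?g ?f = (LINT z|circle_measure. (cmod (\<phi> z))\<^sup>2 * poly p z)"
    unfolding hankel_inner[OF phi f] unfolding L2_inner_def
    by (simp only: complex_cnj_cnj complex_norm_square ac_simps)
  moreover have "2 * Re (L2_inner ?g ?f) \<le> (L2_norm ?g)\<^sup>2 + (L2_norm \<phi>)\<^sup>2"
    using L2_norm_diff_power2[OF H2_conj_L2[OF g] H2_conj_L2[OF f]]
      zero_le_power2[of "L2_norm (\<lambda>z. ?g z - ?f z)"] by (simp add: L2_norm_cnj)
  moreover have "(L2_norm ?g)\<^sup>2 \<le> (L2_norm \<phi>)\<^sup>2"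
    using hankel_le_of_norm_eq[OF eq p] L2_norm_nonneg by (intro power_mono)
  ultimately show ?thesis by simp
qed

text \<open>The cross term \<open>2 * Re (c * z ^ n)\<close> has mean 0 for \<open>n > 0\<close>, so
  normalizing \<open>1 + c * z ^ n\<close> costs only second order in \<open>c\<close>.\<close>

lemma L2_norm_one_plus_monom:
  assumes "n > 0"
  shows "(L2_norm (\<lambda>z. 1 + c * z ^ n))\<^sup>2 = 1 + (cmod c)\<^sup>2"
proof -
  have int: "integrable circle_measure (\<lambda>z. c * z powi n)"
    by (intro integrable_circle_continuous continuous_intros) auto
  have "(L2_norm (\<lambda>z. 1 + c * z ^ n))\<^sup>2 =
      (LINT z|circle_measure. (1 + (cmod c)\<^sup>2) + 2 * Re (c * z powi n))"
    unfolding L2_norm_power2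
  proof (intro Bochner_Integration.integral_cong refl)
    fix z assume "z \<in> space circle_measure"
    then have "cmod (c * z ^ n) = cmod c" by (simp add: norm_mult norm_power)
    moreover have "(cmod (1 + w))\<^sup>2 = 1 + (cmod w)\<^sup>2 + 2 * Re w" for w
      unfolding cmod_power2 by (simp add: power2_eq_square algebra_simps)
    ultimately show "(cmod (1 + c * z ^ n))\<^sup>2 = 1 + (cmod c)\<^sup>2 + 2 * Re (c * z powi n)"
      by simp
  qed
  also have "\<dots> = (1 + (cmod c)\<^sup>2) + 2 * Re (LINT z|circle_measure. c * z powi n)"
    using int circle.prob_space by (simp del: times_complex.sel)
  also have "(LINT z|circle_measure. c * z powi n) = 0"
    using assms integral_powi_circle[of "int n"] by simp
  finally show ?thesis by simp
qed

text \<open>If the moment \<open>a\<close> were nonzero, a perturbation \<open>1 + c * z ^ n\<close>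
  would raise the pairing to first order in \<open>c\<close>, while its norm \<open>s\<close> grows
  only to second order; for small \<open>c\<close> this violates
  \<open>Re_integral_symbol_poly_le\<close>.\<close>

lemma moment_eq_zero:
  assumes phi: "\<phi> \<in> H2" and eq: "hankel_norm \<phi> = ennreal (L2_norm \<phi>)" and n: "n > 0"
  shows "(LINT z|circle_measure. (cmod (\<phi> z))\<^sup>2 * z ^ n) = 0"
proof (rule ccontr)
  let ?N = "(L2_norm \<phi>)\<^sup>2"
  define a where "a = (LINT z|circle_measure. (cmod (\<phi> z))\<^sup>2 * z ^ n)"
  assume "(LINT z|circle_measure. (cmod (\<phi> z))\<^sup>2 * z ^ n) \<noteq> 0"
  then have a: "(cmod a)\<^sup>2 > 0" by (simp add: a_def)
  \<comment> \<open>Small enough that \<open>?N * \<epsilon> < 1\<close>, which is what the final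
    contradiction uses; the added 1 covers \<open>?N = 0\<close>.\<close>
  define \<epsilon> where "\<epsilon> = 1 / (?N + 1)"
  have \<epsilon>: "\<epsilon> > 0" "?N * \<epsilon> < 1"
    using add_nonneg_pos[OF zero_le_power2[of "L2_norm \<phi>"] zero_less_one]
    by (simp_all add: \<epsilon>_def pos_divide_less_eq)
  \<comment> \<open>The phase of \<open>c\<close> makes \<open>c * a\<close> the positive real
    \<open>\<epsilon> * (cmod a)\<^sup>2\<close>.\<close>
  define c where "c = complex_of_real \<epsilon> * cnj a"
  define s where "s = sqrt (1 + (cmod c)\<^sup>2)"
  have s: "s > 0" "s\<^sup>2 = 1 + (cmod c)\<^sup>2" by (simp_all add: s_def add_pos_nonneg)
  define p where "p = smult (complex_of_real (1 / s)) (1 + monom c n)"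
  have p: "poly p z = complex_of_real (1 / s) * (1 + c * z ^ n)" for z
    by (simp add: p_def poly_monom)
  have "(L2_norm (poly p))\<^sup>2 = (1 / s)\<^sup>2 * (L2_norm (\<lambda>z. 1 + c * z ^ n))\<^sup>2"
    using s(1) unfolding L2_norm_power2 p norm_mult power_mult_distrib by (simp add: norm_divide)
  also have "\<dots> = 1"
    unfolding L2_norm_one_plus_monom[OF n] s(2)[symmetric] using s(1) by (simp add: power_divide)
  finally have "L2_norm (poly p) = 1"
    using L2_norm_nonneg[of "poly p"] by (auto simp: power2_eq_1_iff)
  then have le: "Re (LINT z|circle_measure. (cmod (\<phi> z))\<^sup>2 * poly p z) \<le> ?N"
    by (rule Re_integral_symbol_poly_le[OF phi eq])
  have sq: "integrable circle_measure (\<lambda>z. complex_of_real ((cmod (\<phi> z))\<^sup>2))"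
    using phi by (intro integrable_of_real L2_circle_norm_integrable H2_L2)
  have sqn: "integrable circle_measure (\<lambda>z. complex_of_real ((cmod (\<phi> z))\<^sup>2) * z ^ n)"
    by (intro integrable_mult_continuous_right sq continuous_on_power continuous_on_id)
  have "(LINT z|circle_measure. (cmod (\<phi> z))\<^sup>2 * poly p z) =
    (LINT z|circle_measure. complex_of_real (1 / s) * (complex_of_real ((cmod (\<phi> z))\<^sup>2) + c * (complex_of_real ((cmod (\<phi> z))\<^sup>2) * z ^ n)))"
    unfolding p by (intro Bochner_Integration.integral_cong) (simp_all add: algebra_simps)
  also have "\<dots> = complex_of_real (1 / s) * ((LINT z|circle_measure. complex_of_real ((cmod (\<phi> z))\<^sup>2)) + c * a)"
    using sq sqn unfolding a_def by (simp del: of_real_power)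
  also have "(LINT z|circle_measure. complex_of_real ((cmod (\<phi> z))\<^sup>2)) = complex_of_real ?N"
    unfolding L2_norm_power2 by (rule integral_complex_of_real)
  also have "c * a = complex_of_real (\<epsilon> * (cmod a)\<^sup>2)"
    using complex_norm_square[of a] by (simp add: c_def mult.commute)
  also have "complex_of_real (1 / s) * (complex_of_real ?N + complex_of_real (\<epsilon> * (cmod a)\<^sup>2)) =
      complex_of_real ((?N + \<epsilon> * (cmod a)\<^sup>2) / s)"
    by simp
  finally have "(?N + \<epsilon> * (cmod a)\<^sup>2) / s \<le> ?N" using le by (simp del: of_real_power of_real_divide)
  then have 1: "?N + \<epsilon> * (cmod a)\<^sup>2 \<le> ?N * s" using s by (simp add: field_simps)
  \<comment> \<open>As \<open>s \<ge> 1\<close>, replacing \<open>s\<close> by its square removes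
    the root and keeps the bound second order in \<open>\<epsilon>\<close>.\<close>
  have "s \<le> s\<^sup>2"
    using s by (intro self_le_power) (simp_all add: s_def)
  also have "s\<^sup>2 = 1 + \<epsilon> * (\<epsilon> * (cmod a)\<^sup>2)"
    unfolding s(2) c_def by (simp add: norm_mult power2_eq_square algebra_simps)
  finally have "?N * s \<le> ?N * (1 + \<epsilon> * (\<epsilon> * (cmod a)\<^sup>2))"
    by (intro mult_left_mono) simp_all
  with 1 have "\<epsilon> * (cmod a)\<^sup>2 \<le> (?N * \<epsilon>) * (\<epsilon> * (cmod a)\<^sup>2)"
    by (simp add: algebra_simps)
  also have "\<dots> < 1 * (\<epsilon> * (cmod a)\<^sup>2)"
    using \<epsilon> a by (intro mult_strict_right_mono) auto
  finally show False by simp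
qed

text \<open>All Fourier coefficients of \<open>u\<close>, the deviation of the squared modulus from
  its mean, vanish: \<open>moment_eq_zero\<close> handles the negative indices, subtracting the mean
  handles index 0, and realness of \<open>u\<close> reflects this to the positive ones.\<close>

lemma modulus_constant_of_norm_eq:
  assumes phi: "\<phi> \<in> H2" and eq: "hankel_norm \<phi> = ennreal (L2_norm \<phi>)"
  shows "AE z in circle_measure. cmod (\<phi> z) = L2_norm \<phi>"
proof -
  define u where "u z = complex_of_real ((cmod (\<phi> z))\<^sup>2 - (L2_norm \<phi>)\<^sup>2)" for z
  have sq: "integrable circle_measure (\<lambda>z. complex_of_real ((cmod (\<phi> z))\<^sup>2))"
    using phi by (intro integrable_of_real L2_circle_norm_integrable H2_L2)
  have u: "integrable circle_measure u"
    unfolding u_def of_real_diff by (intro Bochner_Integration.integrable_diff sq) simp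
  have neg: "fourier_coeff u (- int n) = 0" for n
  proof -
    have sqn: "integrable circle_measure (\<lambda>z. complex_of_real ((cmod (\<phi> z))\<^sup>2) * z ^ n)"
      by (intro integrable_mult_continuous_right sq continuous_on_power continuous_on_id)
    have zn: "integrable circle_measure (\<lambda>z. complex_of_real ((L2_norm \<phi>)\<^sup>2) * z ^ n)"
      by (intro integrable_circle_continuous continuous_intros)
    have "fourier_coeff u (- int n) =
      (LINT z|circle_measure. complex_of_real ((cmod (\<phi> z))\<^sup>2) * z ^ n - complex_of_real ((L2_norm \<phi>)\<^sup>2) * z ^ n)"
      unfolding fourier_coeff_def u_def
      by (intro Bochner_Integration.integral_cong) (auto simp: cnj_powi_circle algebra_simps)
    also have "\<dots> = (LINT z|circle_measure. complex_of_real ((cmod (\<phi> z))\<^sup>2) * z ^ n) -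
        complex_of_real ((L2_norm \<phi>)\<^sup>2) * (LINT z|circle_measure. z powi int n)"
      using sqn zn by (simp del: of_real_power)
    also have "\<dots> = 0"
    proof (cases "n = 0")
      case True
      have "(LINT z|circle_measure. complex_of_real ((cmod (\<phi> z))\<^sup>2)) = complex_of_real ((L2_norm \<phi>)\<^sup>2)"
        unfolding L2_norm_power2 by (rule integral_complex_of_real)
      then show ?thesis using True integral_powi_circle[of 0] by simp
    next
      case False
      then show ?thesis using moment_eq_zero[OF phi eq, of n] by (simp add: integral_powi_circle del: power_int_of_nat)
    qed
    finally show ?thesis .
  qed
  have pos: "fourier_coeff u (int n) = 0" for n
  proof -
    have "(\<lambda>z. cnj (u z)) = u" by (simp add: u_def fun_eq_iff)
    then show ?thesis using fourier_coeff_cnj[of u "int n"] neg[of n] by simp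
  qed
  have "fourier_coeff u n = 0" for n
    using pos[of "nat n"] neg[of "nat (- n)"] by (cases "n \<ge> 0") auto
  then have "AE z in circle_measure. u z = 0" by (rule fourier_coeff_unique_zero[OF u])
  then show ?thesis
  proof eventually_elim
    case (elim z)
    then have "(cmod (\<phi> z))\<^sup>2 = (L2_norm \<phi>)\<^sup>2" by (simp add: u_def flip: of_real_power)
    then show ?case using L2_norm_nonneg by (simp add: power2_eq_iff_nonneg)
  qed
qed

section \<open>Constant modulus and multiples of inner functions\<close>

lemma inner_function_one: "inner_function (\<lambda>_. 1)"
  using fourier_coeff_powi[of 0] L2_circle_continuous[of "\<lambda>_. 1"]
  by (simp add: inner_function_def H2_def)

lemma inner_multiple_of_modulus_constant:
  assumes phi: "\<phi> \<in> H2" and const: "AE z in circle_measure. cmod (\<phi> z) = r"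
  shows "\<exists>C I. inner_function I \<and> (AE z in circle_measure. \<phi> z = C * I z)"
proof (cases "r = 0")
  case True
  then have "AE z in circle_measure. \<phi> z = 0 * 1" using const by simp
  \<comment> \<open>The zero symbol is 0 times any inner function; the constant 1 serves.\<close>
  then show ?thesis using inner_function_one by blast
next
  case False
  let ?I = "\<lambda>z. \<phi> z * complex_of_real (1 / r)"
  \<comment> \<open>A negative \<open>r\<close> could equal a modulus nowhere, which is impossible
    almost everywhere on a probability space.\<close>
  have r: "r > 0"
  proof (rule ccontr)
    assume "\<not> r > 0"
    then have "r < 0" using False by simp
    then have "cmod (\<phi> z) \<noteq> r" for z using norm_ge_zero[of "\<phi> z"] by linarith
    with const have "AE z in circle_measure. False" by simp
    then show False using circle.AE_False by simp
  qed
  have "fourier_coeff ?I n = complex_of_real (1 / r) * fourier_coeff \<phi> n" for n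
  proof -
    have "fourier_coeff ?I n = (LINT z|circle_measure. complex_of_real (1 / r) * (\<phi> z * cnj (z powi n)))"
      unfolding fourier_coeff_def by (simp only: ac_simps)
    then show ?thesis by (simp add: fourier_coeff_def)
  qed
  then have "?I \<in> H2"
    using phi L2_circle_mult_continuous[OF H2_L2[OF phi], of "\<lambda>_. complex_of_real (1 / r)"]
    by (simp add: H2_def)
  moreover have "AE z in circle_measure. cmod (?I z) = 1"
    using const r by (auto simp: norm_mult norm_divide)
  ultimately have "inner_function ?I" by (simp add: inner_function_def)
  moreover have "\<phi> z = complex_of_real r * ?I z" for z using r by simp
  ultimately show ?thesis by blast
qed

text \<open>Multiplication by \<open>cnj \<phi>\<close> scales every \<open>L2_norm\<close> by
  \<open>r\<close> and the projection does not increase it, so \<open>r\<close> bounds the operator;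
  the polynomial 1 shows that \<open>r\<close> is \<open>L2_norm \<phi>\<close>.\<close>

lemma hankel_norm_of_modulus_constant:
  assumes phi: "\<phi> \<in> H2" and const: "AE z in circle_measure. cmod (\<phi> z) = r" and r: "r \<ge> 0"
  shows "hankel_norm \<phi> = ennreal (L2_norm \<phi>)"
proof (rule antisym)
  have [measurable]: "\<phi> \<in> borel_measurable circle_measure"
    using phi by (intro L2_circle_measurable H2_L2)
  have norm: "L2_norm (\<lambda>z. cnj (\<phi> z) * poly p z) = r * L2_norm (poly p)" for p
  proof -
    have [measurable]: "poly p \<in> borel_measurable circle_measure"
      by (intro borel_measurable_circle_continuous continuous_on_poly_circle)
    have "(LINT z|circle_measure. (cmod (cnj (\<phi> z) * poly p z))\<^sup>2) =
        (LINT z|circle_measure. r\<^sup>2 * (cmod (poly p z))\<^sup>2)"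
      by (rule integral_cong_AE) (use const in \<open>auto simp: norm_mult power_mult_distrib\<close>)
    then show ?thesis using r by (simp add: L2_norm_def real_sqrt_mult)
  qed
  have "L2_norm \<phi> = r"
    using norm[of 1] by (simp add: L2_norm_one L2_norm_cnj)
  then show "hankel_norm \<phi> \<le> ennreal (L2_norm \<phi>)"
    unfolding hankel_norm_def
    by (intro SUP_least ennreal_leI) (use hankel_contraction[OF phi] norm in \<open>metis (mono_tags) mem_Collect_eq mult.right_neutral\<close>)
qed (rule hankel_norm_ge[OF phi])

theorem theorem1:
  fixes \<phi> :: "complex \<Rightarrow> complex"
  assumes "\<phi> \<in> H2"
  shows "hankel_norm \<phi> = ennreal (L2_norm \<phi>) \<longleftrightarrow>
    (\<exists>C I. inner_function I \<and> (AE z in circle_measure. \<phi> z = C * I z))"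
proof
  assume "hankel_norm \<phi> = ennreal (L2_norm \<phi>)"
  then show "\<exists>C I. inner_function I \<and> (AE z in circle_measure. \<phi> z = C * I z)"
    using inner_multiple_of_modulus_constant modulus_constant_of_norm_eq assms by blast
next
  assume "\<exists>C I. inner_function I \<and> (AE z in circle_measure. \<phi> z = C * I z)"
  then obtain C I where I: "AE z in circle_measure. cmod (I z) = 1"
    and C: "AE z in circle_measure. \<phi> z = C * I z"
    by (auto simp: inner_function_def)
  from C I have "AE z in circle_measure. cmod (\<phi> z) = cmod C"
    by eventually_elim (simp add: norm_mult)
  then show "hankel_norm \<phi> = ennreal (L2_norm \<phi>)"
    using hankel_norm_of_modulus_constant[OF assms] by simp
qed

end
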